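(* If $\lambda$ is a JS-partition of type $\alpha$, then its $p$-core is either empty or rectangular of the form $(l^a)$ with $l,a\in\mathbb{N}$ and $l-a\equiv\alpha\pmod p$. More precisely, represent $\alpha\in\{0,\dots,p-1\}$, let $R_p(\lambda)=\left\{\begin{smallmatrix}x_1&\cdots&x_m\\ y_1&\cdots&y_m\end{smallmatrix}\right\}$ and consider the last column $(x_m,y_m)$ (entries mod $p$). Then - $\lambda_{(p)}=(l^{p+l-\alpha})$ if $(x_m,y_m)\in\{(l-1,\alpha-l+1),(\alpha-l-1,l+1),(l,l+1),(\alpha-l,\alpha-l+1)\}$ with $1\le l\le\frac{\alpha}{2}$; - $\lambda_{(p)}=(l^{l-\alpha})$ if $(x_m,y_m)\in\{(l-1,\alpha-l+1),(\alpha-l-1,l+1),(l,l+1),(\alpha-l,\alpha-l+1)\}$ with $\alpha+1\le l<\frac{p+1+\alpha}{2}$; - $\lambda_{(p)}=\emptyset$ if $(x_m,y_m)\in\{(\alpha-1,1),(-1,\alpha+1),(0,1),(\alpha,\alpha+1)\}$.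
   Context: Fix an integer $p\ge 2$. A partition is written $\lambda=(l_1^{a_1},\dots,l_t^{a_t})$ with $l_1>\dots>l_t>0$, $a_i\ge1$; $(l^a)$ denotes the partition with $a$ parts all equal to $l$. It is $p$-regular if all $a_i\le p-1$. A $p$-regular $\lambda$ is a JS-partition if $l_i-l_{i+1}+a_i+a_{i+1}\equiv 0\pmod p$ for $1\le i<t$; its type is $l_1-a_1 \bmod p$. The $p$-core $\lambda_{(p)}$ is the partition obtained from $\lambda$ by repeatedly removing rim hooks of length $p$ until none can be removed (it is independent of choices). Residue symbol: the rim of $\lambda$ is the set of nodes $(i,j)$ of the Young diagram with $(i+1,j+1)$ not in it, ordered from the end of the first row to the start of the last row. The $p$-rim is the union of $p$-segments: the first consists of the first $p$ nodes of the rim (or all of it), each next one consists of the first $p$ (or all remaining) rim nodes starting at the last node of the row just below the lowest row of the previous segment, until the last row is reached. Let $a_1$ = size of the $p$-rim of $\lambda^{(1)}=\lambda$, $r_1$ = its number of parts; removing the $p$-rim gives $\lambda^{(2)}$; iterate until $\lambda^{(m+1)}=\emptyset$, defining $a_j,r_j$ for $\lambda^{(j)}$. The residue symbol $R_p(\lambda)$ has columns $(x_j,y_j)$, $j=1,\dots,m$, with $x_j\equiv a_{m+1-j}-r_{m+1-j}$, $y_j\equiv 1-r_{m+1-j}\pmod p$. *)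

theory Defs
  imports Complex_Main "HOL-Number_Theory.Cong"
begin

definition is_partition :: "nat list \<Rightarrow> bool" where
  "is_partition lam \<longleftrightarrow> sorted_wrt (\<ge>) lam \<and> 0 \<notin> set lam"

definition p_regular :: "nat \<Rightarrow> nat list \<Rightarrow> bool" where
  "p_regular p lam \<longleftrightarrow> (\<forall>l \<in> set lam. count_list lam l \<le> p - 1)"

text \<open>
  Writing a partition as \<open>(l\<^sub>1^a\<^sub>1, \<dots>, l\<^sub>t^a\<^sub>t)\<close> with \<open>l\<^sub>1 > \<dots> > l\<^sub>t > 0\<close>, the list
  of the \<open>l\<^sub>i\<close> is \<open>remdups lam\<close> and \<open>a\<^sub>i\<close> is the multiplicity of \<open>l\<^sub>i\<close>.
\<close>

definition JS_partition :: "nat \<Rightarrow> nat list \<Rightarrow> bool" where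
  "JS_partition p lam \<longleftrightarrow> is_partition lam \<and> p_regular p lam \<and>
     (let ls = remdups lam; a = (\<lambda>i. count_list lam (ls ! i)) in
      \<forall>i. Suc i < length ls \<longrightarrow>
        [int (ls ! i) - int (ls ! Suc i) + int (a i) + int (a (Suc i)) = 0] (mod int p))"

text \<open>The representative in \<open>{0..<p}\<close> of the type; only meaningful for nonempty partitions.\<close>

definition JS_type :: "nat \<Rightarrow> nat list \<Rightarrow> int" where
  "JS_type p lam = (int (hd lam) - int (count_list lam (hd lam))) mod int p"

text \<open>Rows and columns of Young diagrams are numbered from 0.\<close>

definition diagram :: "nat list \<Rightarrow> (nat \<times> nat) set" where
  "diagram lam = {(i, j). i < length lam \<and> j < lam ! i}"

text \<open>
  The rim, listed from the end of the first row to the start of the last row: rows from top to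
  bottom, each row from right to left.
\<close>

definition rim :: "nat list \<Rightarrow> (nat \<times> nat) list" where
  "rim lam = filter (\<lambda>(i, j). (Suc i, Suc j) \<notin> diagram lam)
     (concat (map (\<lambda>i. map (\<lambda>j. (i, j)) (rev [0..<lam ! i])) [0..<length lam]))"

text \<open>
  A rim hook is a connected part of the rim whose removal leaves the diagram of a partition;
  connected parts of the rim are exactly the contiguous blocks of the list \<open>rim lam\<close>.
\<close>

definition removes_rim_hook :: "nat \<Rightarrow> nat list \<Rightarrow> nat list \<Rightarrow> bool" where
  "removes_rim_hook p lam mu \<longleftrightarrow> is_partition mu \<and>
     (\<exists>xs h ys. rim lam = xs @ h @ ys \<and> length h = p \<and> diagram mu = diagram lam - set h)"

definition is_p_core_of :: "nat \<Rightarrow> nat list \<Rightarrow> nat list \<Rightarrow> bool" where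
  "is_p_core_of p lam mu \<longleftrightarrow>
     (removes_rim_hook p)\<^sup>*\<^sup>* lam mu \<and> (\<nexists>nu. removes_rim_hook p mu nu)"

definition p_core :: "nat \<Rightarrow> nat list \<Rightarrow> nat list" where
  "p_core p lam = (THE mu. is_p_core_of p lam mu)"

text \<open>
  The argument \<open>rs\<close> is the part of the rim not yet treated; it always starts at the end of a row.
  The last node of a segment lies in its lowest row, and the first rim node of a row is the
  last node of that row.
\<close>

function p_segments :: "nat \<Rightarrow> (nat \<times> nat) list \<Rightarrow> (nat \<times> nat) list list" where
  "p_segments p rs =
     (if p = 0 \<or> rs = [] then []
      else let s = take p rs in s # p_segments p (filter (\<lambda>(i, j). fst (last s) < i) rs))"
  by pat_completeness auto
termination
proof (relation "measure (\<lambda>(p, rs). length rs)", goal_cases)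
  case 1
  show ?case by simp
next
  case (2 p rs s)
  then have "last s \<in> set rs"
    by (metis in_set_takeD last_in_set neq0_conv take_eq_Nil)
  then have "length (filter (\<lambda>(i, j). fst (last s) < i) rs) < length rs"
    by (rule length_filter_less) (simp add: case_prod_beta)
  then show ?case by simp
qed

declare p_segments.simps [simp del]

definition p_rim :: "nat \<Rightarrow> nat list \<Rightarrow> (nat \<times> nat) set" where
  "p_rim p lam = set (concat (p_segments p (rim lam)))"

text \<open>The row lengths of the diagram left after deleting the \<open>p\<close>-rim.\<close>

definition remove_p_rim :: "nat \<Rightarrow> nat list \<Rightarrow> nat list" where
  "remove_p_rim p lam = filter (\<lambda>k. 0 < k)
     (map (\<lambda>i. card {j. (i, j) \<in> diagram lam - p_rim p lam}) [0..<length lam])"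

lemma set_rim: "set (rim lam) = {(i, j) \<in> diagram lam. (Suc i, Suc j) \<notin> diagram lam}"
  by (force simp: rim_def diagram_def)

lemma finite_diagram: "finite (diagram lam)"
proof -
  have "diagram lam = Sigma {..<length lam} (\<lambda>i. {..<lam ! i})"
    by (auto simp: diagram_def)
  then show ?thesis by simp
qed

lemma rim_eq_Nil_iff: "rim lam = [] \<longleftrightarrow> diagram lam = {}"
proof
  assume empty: "rim lam = []"
  show "diagram lam = {}"
  proof (rule ccontr)
    assume ne: "diagram lam \<noteq> {}"
    define M where "M = Max (fst ` diagram lam)"
    have "M \<in> fst ` diagram lam"
      unfolding M_def using ne finite_diagram by (intro Max_in) auto
    then obtain j where j: "(M, j) \<in> diagram lam" by auto
    have "(Suc M, Suc j) \<notin> diagram lam"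
    proof
      assume "(Suc M, Suc j) \<in> diagram lam"
      then have "Suc M \<in> fst ` diagram lam" by force
      then have "Suc M \<le> M"
        unfolding M_def using finite_diagram by (intro Max_ge) auto
      then show False by simp
    qed
    with j have "(M, j) \<in> set (rim lam)" by (simp add: set_rim)
    with empty show False by simp
  qed
next
  assume "diagram lam = {}"
  then have "set (rim lam) = {}" unfolding set_rim by simp
  then show "rim lam = []" by simp
qed

lemma p_rim_meets_diagram:
  assumes "p \<noteq> 0" "diagram lam \<noteq> {}"
  shows "p_rim p lam \<inter> diagram lam \<noteq> {}"
proof -
  have ne: "rim lam \<noteq> []" using assms by (simp add: rim_eq_Nil_iff)
  then have "hd (rim lam) \<in> set (take p (rim lam))"
    using assms(1) by (cases "rim lam"; cases p) auto
  then have "hd (rim lam) \<in> p_rim p lam"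
    unfolding p_rim_def using ne assms(1)
    by (subst p_segments.simps) (simp add: Let_def)
  moreover have "hd (rim lam) \<in> diagram lam"
    using hd_in_set[OF ne] by (auto simp: set_rim)
  ultimately show ?thesis by blast
qed

lemma remove_p_rim_decreases:
  assumes "p \<noteq> 0" "lam \<noteq> []"
  shows "sum_list (remove_p_rim p lam) + length (remove_p_rim p lam)
           < sum_list lam + length lam"
proof -
  define c where "c = (\<lambda>i. card {j. (i, j) \<in> diagram lam - p_rim p lam})"
  have rem: "remove_p_rim p lam = filter (\<lambda>k. 0 < k) (map c [0..<length lam])"
    by (simp add: remove_p_rim_def c_def)
  have len: "length (remove_p_rim p lam) \<le> length lam"
    unfolding rem by (metis length_filter_le length_map length_upt diff_zero)
  have filt: "sum_list (filter (\<lambda>k. 0 < k) xs) = sum_list xs" for xs :: "nat list"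
    by (induction xs) auto
  have sum1: "sum_list (remove_p_rim p lam) = (\<Sum>i<length lam. c i)"
    unfolding rem filt by (simp add: interv_sum_list_conv_sum_set_nat atLeast0LessThan)
  have sum2: "sum_list lam = (\<Sum>i<length lam. lam ! i)"
    by (simp add: sum_list_sum_nth atLeast0LessThan)
  have le: "c i \<le> lam ! i" for i
  proof -
    have "c i \<le> card {..<lam ! i}"
      unfolding c_def by (intro card_mono) (auto simp: diagram_def)
    then show ?thesis by simp
  qed
  show ?thesis
  proof (cases "diagram lam = {}")
    case True
    then have "remove_p_rim p lam = []"
      by (simp add: rem c_def filter_empty_conv)
    then show ?thesis using assms(2) by simp
  next
    case False
    then obtain i j where ij: "(i, j) \<in> p_rim p lam" "(i, j) \<in> diagram lam"
      using p_rim_meets_diagram[OF assms(1)] by fast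
    have "c i < card {..<lam ! i}"
      unfolding c_def using ij by (intro psubset_card_mono) (auto simp: diagram_def)
    then have "c i < lam ! i" by simp
    moreover have "i < length lam" using ij by (simp add: diagram_def)
    ultimately have "(\<Sum>i<length lam. c i) < (\<Sum>i<length lam. lam ! i)"
      using le by (intro sum_strict_mono_ex1) auto
    then show ?thesis using sum1 sum2 len by simp
  qed
qed

text \<open>
  The list of columns \<open>(x\<^sub>1, y\<^sub>1), \<dots>, (x\<^sub>m, y\<^sub>m)\<close>, with entries reduced to \<open>{0..<p}\<close>.
  The column computed from the partition itself is the last one.
\<close>

function residue_symbol :: "nat \<Rightarrow> nat list \<Rightarrow> (int \<times> int) list" where
  "residue_symbol p lam =
     (if p = 0 \<or> lam = [] then []
      else residue_symbol p (remove_p_rim p lam) @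
        [((int (card (p_rim p lam)) - int (length lam)) mod int p,
          (1 - int (length lam)) mod int p)])"
  by pat_completeness auto
termination
  by (relation "measure (\<lambda>(p, lam). sum_list lam + length lam)")
     (auto intro: remove_p_rim_decreases)

declare residue_symbol.simps [simp del]

text \<open>Membership of a column in a set of columns, entries being read modulo \<open>p\<close>.\<close>

definition column_in_mod :: "nat \<Rightarrow> int \<times> int \<Rightarrow> (int \<times> int) set \<Rightarrow> bool" where
  "column_in_mod p c S \<longleftrightarrow>
     (\<exists>(u, v) \<in> S. [fst c = u] (mod int p) \<and> [snd c = v] (mod int p))"

end

(*
  Encode a partition by its beads lam_i - i (rows numbered from 1). Removing a rim p-hook removes p
  nodes of consecutive contents, so by telescoping it preserves how many beads lie in each residue
  class; a partition without removable rim p-hooks has a bead set closed under x -> x - p, and is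
  determined by these numbers. For a JS-partition with n parts the JS condition makes the bead
  intervals of the blocks of equal parts concatenate modulo p, so the first n beads have the residues
  alpha, ..., alpha + n - 1. A rectangle (l^a) with l + a <= p and l - a = alpha (mod p) has the same
  residues as soon as n = a or n = -l (mod p). Hence the core depends only on alpha and n mod p, and
  n mod p is read off from y_m = 1 - n.
*)

theory Submission
  imports Defs
begin

section \<open>Row lengths, beads and contents\<close>

definition part :: "nat list \<Rightarrow> nat \<Rightarrow> nat" where
  "part lam i = (if i < length lam then lam ! i else 0)"

text \<open>Rows count from 0, so the extra \<open>- 1\<close> gives the usual lam_i - i. As
  \<open>part\<close> is zero past the last row, every partition has infinitely many beads, among
  them all sufficiently negative integers, and partitions of different lengths can be compared on a
  common range of rows.\<close>

definition bead :: "nat list \<Rightarrow> nat \<Rightarrow> int" where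
  "bead lam i = int (part lam i) - int i - 1"

definition content :: "nat \<times> nat \<Rightarrow> int" where
  "content = (\<lambda>(i, j). int j - int i)"

text \<open>Summing an arbitrary periodic function over the beads encodes all residue counts at
  once: the indicator of a class recovers its count, while telescoping and shifting of intervals
  become identities of sums.\<close>

definition periodic :: "nat \<Rightarrow> (int \<Rightarrow> int) \<Rightarrow> bool" where
  "periodic p g \<longleftrightarrow> (\<forall>x y. [x = y] (mod int p) \<longrightarrow> g x = g y)"

lemma diagram_eq_part: "diagram lam = {(i, j). j < part lam i}"
  by (auto simp: diagram_def part_def split: if_splits)

lemma part_antimono:
  assumes "is_partition lam" "i \<le> k"
  shows "part lam k \<le> part lam i"
proof (cases "i = k")
  case False
  with assms show ?thesis
    by (auto simp: part_def is_partition_def sorted_wrt_iff_nth_less)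
qed simp

lemma part_pos: "is_partition lam \<Longrightarrow> 0 < part lam i \<longleftrightarrow> i < length lam"
  by (auto simp: part_def is_partition_def) (metis gr0I nth_mem)

lemma partition_eqI:
  assumes "is_partition lam" "is_partition mu" "\<And>i. part lam i = part mu i"
  shows "lam = mu"
proof -
  have "i < length lam \<longleftrightarrow> i < length mu" for i
    using assms part_pos by metis
  then have len: "length lam = length mu"
    by (metis linorder_neqE_nat less_irrefl)
  show ?thesis
  proof (rule nth_equalityI[OF len])
    fix i assume "i < length lam"
    then show "lam ! i = mu ! i"
      using assms(3)[of i] len by (simp add: part_def)
  qed
qed

lemma bead_strict_antimono:
  assumes "is_partition lam" "i < k"
  shows "bead lam k < bead lam i"
  using part_antimono[OF assms(1), of i k] assms(2) by (simp add: bead_def)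

text \<open>Provides the partition left after deleting a rim hook, where at first only a set of
  nodes is at hand.\<close>

lemma down_closed_is_diagram:
  assumes "finite S"
    and down: "\<And>i j. (Suc i, j) \<in> S \<Longrightarrow> (i, j) \<in> S" "\<And>i j. (i, Suc j) \<in> S \<Longrightarrow> (i, j) \<in> S"
  obtains mu where "is_partition mu" "diagram mu = S"
proof -
  have left: "(i, j') \<in> S" if "(i, j) \<in> S" "j' \<le> j" for i j j'
    using that(2,1) by (induction rule: inc_induct) (auto intro: down(2))
  have up: "(i', j) \<in> S" if "(i, j) \<in> S" "i' \<le> i" for i i' j
    using that(2,1) by (induction rule: inc_induct) (auto intro: down(1))
  define c where "c i = card {j. (i, j) \<in> S}" for i
  have fin: "finite {j. (i, j) \<in> S}" for i
    by (rule finite_subset[OF _ finite_imageI[OF assms(1), of snd]]) force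
  have row: "{j. (i, j) \<in> S} = {..<c i}" for i
  proof -
    let ?A = "{j. (i, j) \<in> S}"
    define m where "m = (LEAST j. j \<notin> ?A)"
    have "\<exists>j. j \<notin> ?A" using fin[of i] by (metis ex_new_if_finite infinite_UNIV_nat)
    then have "m \<notin> ?A" unfolding m_def by (rule LeastI_ex)
    moreover have "j \<in> ?A" if "j < m" for j
      using not_less_Least[of j "\<lambda>j. j \<notin> ?A"] that unfolding m_def by blast
    ultimately have "?A = {..<m}" using left by (auto simp: not_less[symmetric])
    then show ?thesis by (simp add: c_def)
  qed
  have mem: "(i, j) \<in> S \<longleftrightarrow> j < c i" for i j using row[of i] by blast
  have anti: "c k \<le> c i" if "i \<le> k" for i k
    unfolding c_def by (rule card_mono[OF fin]) (use up that in auto)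
  have "\<exists>n. c n = 0"
  proof -
    obtain n where "n \<notin> fst ` S" using assms(1) by (metis ex_new_if_finite finite_imageI infinite_UNIV_nat)
    then have "\<not> 0 < c n" using mem[of n 0] by force
    then show ?thesis by auto
  qed
  \<comment> \<open>The list is cut at the first empty row, because \<open>is_partition\<close>
    forbids zero parts.\<close>
  define n where "n = (LEAST n. c n = 0)"
  have n0: "c n = 0" unfolding n_def by (rule LeastI_ex) fact
  have npos: "0 < c i" if "i < n" for i
    using not_less_Least[of i "\<lambda>n. c n = 0"] that unfolding n_def by auto
  have nz: "c i = 0" if "n \<le> i" for i using anti[OF that] n0 by simp
  define mu where "mu = map c [0..<n]"
  have "is_partition mu"
    using npos by (force simp: mu_def is_partition_def sorted_wrt_iff_nth_less anti)
  moreover have "part mu i = c i" for i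
    using nz[of i] by (simp add: part_def mu_def)
  then have "diagram mu = S" by (auto simp: diagram_eq_part mem)
  ultimately show ?thesis by (rule that)
qed

section \<open>The rim as a list of consecutive contents\<close>

text \<open>Row i of the rim starts in the column where row i + 1 ends. Below the last row the
  truncated subtraction gives 0, so the whole last row belongs to the rim.\<close>

lemma rim_rows:
  "rim lam = concat (map (\<lambda>i. map (Pair i) (rev [part lam (Suc i) - 1..<lam ! i])) [0..<length lam])"
proof -
  have *: "filter (\<lambda>j. q \<le> Suc j) [0..<m] = [q - 1..<m]" for q m :: nat
  proof (induction m)
    case (Suc m) then show ?case by auto
  qed simp
  show ?thesis
    unfolding rim_def filter_concat map_map
    by (rule arg_cong[where f = concat], rule map_cong[OF refl])
       (simp add: filter_map comp_def rev_filter[symmetric] diagram_eq_part not_less *)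
qed

lemma map_int_upt_shift:
  "map (\<lambda>j. int j - s) [a..<b] = [int a - s..int b - 1 - s]"
proof (induction b)
  case (Suc b)
  then show ?case
    by (auto simp: upto_rec2[of "int a - s" "int b - s"] algebra_simps)
qed simp

text \<open>The last listed rim node of a row lies directly above the first listed one of the next
  row, so the content drops by exactly 1 there, as it does within a row. Blocks of the rim list are
  therefore intervals of contents.\<close>

lemma contents_rim:
  assumes "is_partition lam" "lam \<noteq> []"
  shows "map content (rim lam) = rev [1 - int (length lam)..int (lam ! 0) - 1]"
proof -
  define n where "n = length lam"
  define row where "row i = rev [int (part lam (Suc i) - 1) - int i..int (lam ! i) - 1 - int i]" for i
  have rows: "concat (map row [k..<n]) = rev [1 - int n..int (lam ! k) - 1 - int k]"
    if "k < n" for k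
  proof -
    \<comment> \<open>The induction runs from the bottom row upwards.\<close>
    have "k \<le> n - 1" using that by simp
    then show ?thesis
    proof (induction rule: inc_induct)
      case base
      show ?case using that by (simp add: row_def part_def n_def upt_conv_Cons of_nat_diff algebra_simps)
    next
      case (step k)
      then have k: "k < n" "Suc k < n" by auto
      have q: "part lam (Suc k) = lam ! Suc k" "0 < lam ! Suc k" "lam ! Suc k \<le> lam ! k"
        using part_pos[OF assms(1), of "Suc k"] part_antimono[OF assms(1), of k "Suc k"] k
        by (auto simp: part_def n_def)
      have "[1 - int n..int (lam ! k) - 1 - int k] =
          [1 - int n..int (lam ! Suc k) - 1 - int (Suc k)] @
          [int (lam ! Suc k) - 1 - int k..int (lam ! k) - 1 - int k]"
        using q k upto_split1[of "1 - int n" "int (lam ! Suc k) - 1 - int k" "int (lam ! k) - 1 - int k"]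
        by (simp add: algebra_simps)
      then show ?case using step k q by (simp add: upt_conv_Cons[of k] row_def of_nat_diff)
    qed
  qed
  have "map content (rim lam) = concat (map row [0..<n])"
    unfolding rim_rows map_concat map_map n_def
    by (rule arg_cong[where f = concat], rule map_cong[OF refl])
       (simp add: content_def row_def comp_def rev_map[symmetric] map_int_upt_shift)
  with rows[of 0] assms(2) show ?thesis by (simp add: n_def)
qed

lemma distinct_rim:
  assumes "is_partition lam"
  shows "distinct (rim lam)"
proof (cases "lam = []")
  case False
  then have "distinct (map content (rim lam))"
    using contents_rim[OF assms] by simp
  then show ?thesis by (simp add: distinct_map)
qed (simp add: rim_def)

lemma content_rim_nth:
  assumes "is_partition lam" "k < length (rim lam)"
  shows "content (rim lam ! k) = int (part lam 0) - 1 - int k"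
proof -
  have ne: "lam \<noteq> []" using assms(2) by (auto simp: rim_def)
  note c = contents_rim[OF assms(1) ne]
  have "length (rim lam) = nat (int (lam ! 0) - 1 - (1 - int (length lam)) + 1)"
    using arg_cong[OF c, of length] by simp
  moreover have "content (rim lam ! k) = rev [1 - int (length lam)..int (lam ! 0) - 1] ! k"
    using arg_cong[OF c, of "\<lambda>xs. xs ! k"] assms(2) by simp
  moreover have "0 < length lam" using ne by simp
  ultimately show ?thesis
    using assms(2) by (simp add: rev_nth part_def nth_upto del: length_greater_0_conv)
qed

lemma length_rim:
  assumes "is_partition lam" "lam \<noteq> []"
  shows "int (length (rim lam)) = int (part lam 0) + int (length lam) - 1"
proof -
  have "0 < length lam" using assms(2) by simp
  then have "length (rim lam) = nat (int (lam ! 0) - 1 - (1 - int (length lam)) + 1)"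
    using arg_cong[OF contents_rim[OF assms], of length] by simp
  with \<open>0 < length lam\<close> show ?thesis by (simp add: part_def del: length_greater_0_conv)
qed

section \<open>Bead sums under removal of rim hooks\<close>

text \<open>Along row i the differences telescope from the bead \<open>- i - 1\<close> of an empty
  row to the actual bead. Removing nodes thus changes a bead sum only by the terms of those
  nodes.\<close>

lemma bead_sum_eq_diagram_sum:
  fixes g :: "int \<Rightarrow> int"
  assumes "length lam \<le> N"
  shows "(\<Sum>i<N. g (bead lam i)) =
    (\<Sum>i<N. g (- int i - 1)) + (\<Sum>x\<in>diagram lam. g (content x) - g (content x - 1))"
proof -
  have "diagram lam = Sigma {..<N} (\<lambda>i. {..<part lam i})"
    using assms by (auto simp: diagram_eq_part part_def split: if_splits)
  then have "(\<Sum>x\<in>diagram lam. g (content x) - g (content x - 1)) =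
      (\<Sum>i<N. \<Sum>j<part lam i. g (int j - int i) - g (int j - int i - 1))"
    by (simp add: sum.Sigma content_def case_prod_beta)
  also have "\<dots> = (\<Sum>i<N. g (bead lam i) - g (- int i - 1))"
  proof (rule sum.cong[OF refl])
    fix i
    have "(\<Sum>j<m. g (int j - int i) - g (int j - int i - 1)) = g (int m - int i - 1) - g (- int i - 1)"
      for m by (induction m) (simp_all add: algebra_simps)
    then show "(\<Sum>j<part lam i. g (int j - int i) - g (int j - int i - 1)) =
        g (bead lam i) - g (- int i - 1)" by (simp add: bead_def)
  qed
  finally show ?thesis by (simp add: sum_subtractf)
qed

lemma rim_hook_preserves_bead_sum:
  assumes "is_partition lam" "removes_rim_hook p lam mu" "periodic p g" "length lam \<le> N"
  shows "(\<Sum>i<N. g (bead mu i)) = (\<Sum>i<N. g (bead lam i))" "length mu \<le> length lam"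
proof -
  obtain xs h ys where h: "rim lam = xs @ h @ ys" "length h = p"
    and mu: "diagram mu = diagram lam - set h" "is_partition mu"
    using assms(2) by (auto simp: removes_rim_hook_def)
  have "i < length lam" if "i < length mu" for i
  proof -
    have "(i, 0) \<in> diagram mu" using that part_pos[OF mu(2), of i] by (simp add: diagram_eq_part)
    then show ?thesis using mu(1) by (auto simp: diagram_def)
  qed
  then show le: "length mu \<le> length lam" by (metis leI less_irrefl)
  let ?f = "\<lambda>x. g (content x) - g (content x - 1)"
  have cont: "content (h ! k) = int (part lam 0) - 1 - int (length xs) - int k" if "k < p" for k
    using content_rim_nth[OF assms(1), of "length xs + k"] h that by (simp add: nth_append)
  define c where "c = int (part lam 0) - 1 - int (length xs)"
  have "distinct h" using distinct_rim[OF assms(1)] h(1) by simp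
  then have "(\<Sum>x\<in>set h. ?f x) = (\<Sum>k<p. ?f (h ! k))"
    by (simp add: sum.distinct_set_conv_list sum_list_sum_nth h(2) atLeast0LessThan)
  also have "\<dots> = (\<Sum>k<p. g (c - int k) - g (c - int (Suc k)))"
    by (rule sum.cong) (simp_all add: cont c_def algebra_simps)
  \<comment> \<open>The hook has contents \<open>c\<close> down to \<open>c - p + 1\<close>, so only
    two values of \<open>g\<close> at distance \<open>p\<close> survive.\<close>
  also have "\<dots> = g c - g (c - int p)"
    by (subst sum_lessThan_telescope') simp
  also have "\<dots> = 0" using assms(3) by (simp add: periodic_def cong_iff_dvd_diff)
  finally have "(\<Sum>x\<in>set h. ?f x) = 0" .
  moreover have "set h \<subseteq> diagram lam" using h(1) set_rim[of lam] by auto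
  then have "(\<Sum>x\<in>diagram lam - set h. ?f x) = (\<Sum>x\<in>diagram lam. ?f x) - (\<Sum>x\<in>set h. ?f x)"
    by (intro sum_diff finite_diagram)
  ultimately show "(\<Sum>i<N. g (bead mu i)) = (\<Sum>i<N. g (bead lam i))"
    using le assms(4) by (simp add: bead_sum_eq_diagram_sum mu(1))
qed

lemma core_preserves_bead_sum:
  assumes "(removes_rim_hook p)\<^sup>*\<^sup>* lam mu" "is_partition lam" "periodic p g"
  shows "is_partition mu \<and> length mu \<le> length lam \<and>
    (\<Sum>i<length lam. g (bead mu i)) = (\<Sum>i<length lam. g (bead lam i))"
  using assms(1)
proof induction
  case (step mu nu)
  then show ?case
    using rim_hook_preserves_bead_sum[OF _ step.hyps(2) assms(3), of "length lam"]
    by (auto simp: removes_rim_hook_def)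
qed (simp add: assms(2))

section \<open>Existence of cores and of removable hooks\<close>

text \<open>Each removal of a nonempty hook shrinks the diagram. Existence is required because
  \<open>p_core\<close> is a definite description.\<close>

lemma p_core_exists:
  assumes "p \<noteq> 0"
  shows "\<exists>mu. is_p_core_of p lam mu"
proof (induction "card (diagram lam)" arbitrary: lam rule: less_induct)
  case less
  show ?case
  proof (cases "\<exists>nu. removes_rim_hook p lam nu")
    case True
    then obtain nu where nu: "removes_rim_hook p lam nu" ..
    then obtain xs h ys where h: "rim lam = xs @ h @ ys" "length h = p"
      "diagram nu = diagram lam - set h" by (auto simp: removes_rim_hook_def)
    have "hd h \<in> set h" using h(2) assms by (cases h) auto
    moreover have "set h \<subseteq> diagram lam" using h(1) set_rim[of lam] by auto
    ultimately have "hd h \<in> diagram lam" "hd h \<notin> diagram nu"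
      by (auto simp only: h(3))
    moreover have "diagram nu \<subseteq> diagram lam" unfolding h(3) by (rule Diff_subset)
    ultimately have "diagram nu \<subset> diagram lam" by blast
    then have "card (diagram nu) < card (diagram lam)"
      by (rule psubset_card_mono[OF finite_diagram])
    then obtain mu where "is_p_core_of p nu mu" using less by blast
    with nu have "is_p_core_of p lam mu"
      unfolding is_p_core_of_def by (simp add: converse_rtranclp_into_rtranclp)
    then show ?thesis ..
  next
    case False
    then show ?thesis unfolding is_p_core_of_def by blast
  qed
qed

text \<open>Moving the bead \<open>hi\<close> to the gap \<open>hi - p\<close> amounts to deleting
  the rim nodes with contents from \<open>hi - p + 1\<close> to \<open>hi\<close>. If a deleted node
  had a remaining node below it, \<open>hi - p\<close> would be a bead; if it had one to its right,
  \<open>hi\<close> would lie strictly between two consecutive beads.\<close>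

lemma removable_rim_hook:
  assumes part: "is_partition lam" and notin: "bead lam i - int p \<notin> range (bead lam)"
  shows "\<exists>mu. removes_rim_hook p lam mu"
proof -
  define hi where "hi = bead lam i"
  define lo where "lo = hi - int p + 1"
  define n where "n = length lam"
  \<comment> \<open>All integers below \<open>- n\<close> are beads of empty rows, so the gap lies
    no lower and the required contents do not run off the end of the rim.\<close>
  have lo: "1 - int n \<le> lo"
  proof (rule ccontr)
    assume "\<not> 1 - int n \<le> lo"
    then have "n \<le> nat (- lo)" "0 \<le> - lo" by auto
    then have "bead lam (nat (- lo)) = hi - int p" by (simp add: bead_def part_def n_def lo_def)
    with notin show False unfolding hi_def by (metis rangeI)
  qed
  have p: "p \<noteq> 0" using notin by auto
  have ne: "lam \<noteq> []"
  proof
    assume "lam = []"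
    then have "bead lam i - int p = bead lam (i + p)" by (simp add: bead_def part_def)
    with notin show False by (metis rangeI)
  qed
  have hi_le: "hi \<le> int (part lam 0) - 1"
    using part_antimono[OF part, of 0 i] by (simp add: hi_def bead_def)
  \<comment> \<open>The number of rim nodes with content above \<open>hi\<close>, which precede the
    hook in the list.\<close>
  define m where "m = nat (int (part lam 0) - 1 - hi)"
  have m: "int m = int (part lam 0) - 1 - hi" using hi_le by (simp add: m_def)
  have len: "m + p \<le> length (rim lam)"
    using length_rim[OF part ne] lo m by (simp add: lo_def n_def)
  define h where "h = take p (drop m (rim lam))"
  have hlen: "length h = p" using len by (simp add: h_def)
  have split: "rim lam = take m (rim lam) @ h @ drop p (drop m (rim lam))"
    unfolding h_def by (simp only: append_take_drop_id)
  have set_h: "set h = {x \<in> set (rim lam). lo \<le> content x \<and> content x \<le> hi}"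
  proof (intro equalityI subsetI)
    fix x assume "x \<in> set h"
    then obtain k where k: "k < p" "x = h ! k" using hlen by (auto simp: in_set_conv_nth)
    then have "x = rim lam ! (m + k)" "m + k < length (rim lam)" using len by (auto simp: h_def)
    then show "x \<in> {x \<in> set (rim lam). lo \<le> content x \<and> content x \<le> hi}"
      using content_rim_nth[OF part, of "m + k"] m k by (simp add: lo_def)
  next
    fix x assume x: "x \<in> {x \<in> set (rim lam). lo \<le> content x \<and> content x \<le> hi}"
    then obtain k where k: "k < length (rim lam)" "x = rim lam ! k" by (auto simp: in_set_conv_nth)
    then have "content x = int (part lam 0) - 1 - int k" using content_rim_nth[OF part] by simp
    with x m have "m \<le> k" "k < m + p" by (auto simp: lo_def)
    then have "x = h ! (k - m)" "k - m < length h" using k len by (auto simp: h_def)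
    then show "x \<in> set h" by (metis nth_mem)
  qed
  have rim_iff: "(r, j) \<in> set (rim lam) \<longleftrightarrow> j < part lam r \<and> part lam (Suc r) \<le> Suc j" for r j
    by (auto simp: set_rim diagram_eq_part)
  have fin: "finite (diagram lam - set h)" by (simp add: finite_diagram)
  obtain mu where "is_partition mu" "diagram mu = diagram lam - set h"
  proof (rule down_closed_is_diagram[OF fin])
    fix r j assume "(Suc r, j) \<in> diagram lam - set h"
    then have a: "j < part lam (Suc r)" "(Suc r, j) \<notin> set h" by (auto simp: diagram_eq_part)
    have "(r, j) \<notin> set h"
    proof
      assume "(r, j) \<in> set h"
      then have b: "part lam (Suc r) \<le> Suc j" "lo \<le> int j - int r" "int j - int r \<le> hi"
        by (auto simp: set_h rim_iff content_def)
      have eq: "part lam (Suc r) = Suc j" using a b by simp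
      \<comment> \<open>The node below is on the rim but outside the hook, so its content must be
        \<open>lo - 1\<close>.\<close>
      have "(Suc r, j) \<in> set (rim lam)"
        using a eq part_antimono[OF part, of "Suc r" "Suc (Suc r)"] by (simp add: rim_iff)
      with a b have "int j - int r = lo" by (auto simp: set_h content_def)
      then have "bead lam (Suc r) = hi - int p" using eq by (simp add: bead_def lo_def)
      with notin show False unfolding hi_def by (metis rangeI)
    qed
    moreover have "j < part lam r" using a part_antimono[OF part, of r "Suc r"] by simp
    ultimately show "(r, j) \<in> diagram lam - set h" by (simp add: diagram_eq_part)
  next
    fix r j assume "(r, Suc j) \<in> diagram lam - set h"
    then have a: "Suc j < part lam r" "(r, Suc j) \<notin> set h" by (auto simp: diagram_eq_part)
    have "(r, j) \<notin> set h"
    proof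
      assume "(r, j) \<in> set h"
      then have b: "part lam (Suc r) \<le> Suc j" "lo \<le> int j - int r" "int j - int r \<le> hi"
        by (auto simp: set_h rim_iff content_def)
      have "(r, Suc j) \<in> set (rim lam)" using a b by (simp add: rim_iff)
      with a b have eq: "int j - int r = hi" by (auto simp: set_h content_def)
      show False
      proof (cases "i \<le> r")
        case True
        then show False
          using eq a part_antimono[OF part True] by (simp add: hi_def bead_def)
      next
        case False
        then have "Suc r \<le> i" by simp
        then show False
          using eq b part_antimono[OF part, of "Suc r" i] by (simp add: hi_def bead_def)
      qed
    qed
    then show "(r, j) \<in> diagram lam - set h" using a by (simp add: diagram_eq_part)
  qed
  then show ?thesis
    unfolding removes_rim_hook_def using split hlen by blast
qed

section \<open>Uniqueness of cores\<close>

text \<open>Within one residue class both bead sets are closed under subtracting \<open>p\<close>,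
  so one contains the other; equal counts then force equality. The rows are recovered by sorting the
  beads.\<close>

lemma flush_partition_unique:
  assumes "is_partition lam" "is_partition mu" "p \<noteq> 0"
    and len: "length lam \<le> N" "length mu \<le> N"
    and flush: "\<And>x. x \<in> range (bead lam) \<Longrightarrow> x - int p \<in> range (bead lam)"
      "\<And>x. x \<in> range (bead mu) \<Longrightarrow> x - int p \<in> range (bead mu)"
    and sums: "\<And>g. periodic p g \<Longrightarrow> (\<Sum>i<N. g (bead lam i)) = (\<Sum>i<N. g (bead mu i))"
  shows "lam = mu"
proof -
  have iter: "x - int p * int k \<in> range (bead nu)"
    if "x \<in> range (bead nu)" "\<And>x. x \<in> range (bead nu) \<Longrightarrow> x - int p \<in> range (bead nu)" for x k nu
  proof (induction k)
    case (Suc k)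
    then show ?case using that(2)[OF Suc] by (simp add: algebra_simps)
  qed (simp add: that)
  have down: "y \<in> range (bead nu)"
    if "x \<in> range (bead nu)" "\<And>x. x \<in> range (bead nu) \<Longrightarrow> x - int p \<in> range (bead nu)"
      "y \<le> x" "[x = y] (mod int p)" for x y nu
  proof -
    have "int p dvd x - y" using that(4) by (simp add: cong_iff_dvd_diff)
    then obtain q where q: "x - y = int p * q" ..
    then have "0 \<le> q" using that(3) assms(3) by (metis diff_ge_0_iff_ge of_nat_0_less_iff zero_le_mult_iff not_le neq0_conv)
    then have "x - int p * q \<in> range (bead nu)" using iter[OF that(1,2), of "nat q"] by simp
    moreover have "x - int p * q = y" using q by simp
    ultimately show ?thesis by simp
  qed
  \<comment> \<open>From row \<open>N\<close> on all rows are empty, and their beads are exactly the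
    integers below \<open>- N\<close>.\<close>
  have low: "x \<in> bead nu ` {..<N} \<longleftrightarrow> x \<in> range (bead nu) \<and> - int N \<le> x"
    if "length nu \<le> N" for nu x
  proof -
    have "- int N \<le> bead nu i \<longleftrightarrow> i < N" for i
      using that by (auto simp: bead_def part_def)
    then show ?thesis by auto
  qed
  have inj: "inj_on (bead nu) A" if "is_partition nu" for nu A
    by (rule inj_onI) (metis bead_strict_antimono[OF that] linorder_neqE_nat less_irrefl)
  define A where "A nu k = {x \<in> bead nu ` {..<N}. [x = k] (mod int p)}" for nu k
  have A_eq: "A lam k = A mu k" for k
  proof -
    have fin: "finite (A nu k)" for nu by (simp add: A_def)
    have card_A: "(\<Sum>i<N. if [bead nu i = k] (mod int p) then 1 else 0) = int (card (A nu k))"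
      if "is_partition nu" for nu
    proof -
      have "A nu k = bead nu ` {i \<in> {..<N}. [bead nu i = k] (mod int p)}" by (auto simp: A_def)
      then have "card (A nu k) = card {i \<in> {..<N}. [bead nu i = k] (mod int p)}"
        by (simp add: card_image inj[OF that])
      then show ?thesis by (simp add: sum.If_cases Int_def)
    qed
    \<comment> \<open>The indicator of the class of \<open>k\<close> turns the equality of sums into
      one of counts.\<close>
    have "periodic p (\<lambda>x. if [x = k] (mod int p) then 1 else 0)"
      by (auto simp: periodic_def) (meson cong_trans cong_sym)+
    from sums[OF this] have card: "card (A lam k) = card (A mu k)"
      using assms(1,2) by (simp add: card_A)
    have "A lam k \<subseteq> A mu k \<or> A mu k \<subseteq> A lam k"
    proof (rule ccontr)
      assume "\<not> ?thesis"
      then obtain x y where x: "x \<in> A lam k" "x \<notin> A mu k" and y: "y \<in> A mu k" "y \<notin> A lam k" by blast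
      have cong: "[x = y] (mod int p)" "[y = x] (mod int p)"
        using x y by (auto simp: A_def intro: cong_trans cong_sym)
      show False
      proof (cases "x \<le> y")
        case True
        then have "x \<in> range (bead mu)"
          using down[of y mu x] y(1) flush(2) cong by (auto simp: A_def)
        then show False using x low[OF len(1)] low[OF len(2)] by (auto simp: A_def)
      next
        case False
        then have "y \<in> range (bead lam)"
          using down[of x lam y] x(1) flush(1) cong by (auto simp: A_def)
        then show False using y low[OF len(1)] low[OF len(2)] by (auto simp: A_def)
      qed
    qed
    then show ?thesis using card_subset_eq[OF fin] card by metis
  qed
  have im: "bead lam ` {..<N} = bead mu ` {..<N}"
  proof -
    have "x \<in> bead lam ` {..<N} \<longleftrightarrow> x \<in> bead mu ` {..<N}" for x
      using arg_cong[OF A_eq[of x], of "\<lambda>A. x \<in> A"] by (simp add: A_def)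
    then show ?thesis by blast
  qed
  have srt: "sorted (rev (map (bead nu) [0..<N]))" "distinct (map (bead nu) [0..<N])"
    if "is_partition nu" for nu
    using sorted_wrt_mono_rel[OF _ sorted_wrt_upt, of 0 N "\<lambda>i j. bead nu j \<le> bead nu i"]
      bead_strict_antimono[OF that]
    by (auto simp: sorted_wrt_rev sorted_wrt_map less_imp_le distinct_map inj[OF that])
  have "rev (map (bead lam) [0..<N]) = rev (map (bead mu) [0..<N])"
    using srt[OF assms(1)] srt[OF assms(2)] im
    by (intro sorted_distinct_set_unique) (auto simp: atLeast0LessThan)
  then have "bead lam i = bead mu i" if "i < N" for i using that by simp
  then have "part lam i = part mu i" for i
    using len by (cases "i < N") (auto simp: bead_def part_def)
  then show ?thesis using assms(1,2) by (rule partition_eqI[rotated 2])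
qed

text \<open>Identifies the core without exhibiting hook removals from \<open>lam\<close> to
  \<open>mu\<close>: any core of \<open>lam\<close> is closed under subtracting \<open>p\<close> by
  \<open>removable_rim_hook\<close> and has the bead sums of \<open>lam\<close>, hence equals
  \<open>mu\<close>.\<close>

lemma p_core_eqI:
  assumes "p \<noteq> 0" "is_partition lam" "is_partition mu" "length mu \<le> length lam"
    and flush: "\<And>x. x \<in> range (bead mu) \<Longrightarrow> x - int p \<in> range (bead mu)"
    and sums: "\<And>g. periodic p g \<Longrightarrow>
      (\<Sum>i<length lam. g (bead mu i)) = (\<Sum>i<length lam. g (bead lam i))"
  shows "p_core p lam = mu"
proof -
  have eq: "nu = mu" if "is_p_core_of p lam nu" for nu
  proof -
    have r: "(removes_rim_hook p)\<^sup>*\<^sup>* lam nu" and c: "\<nexists>nu'. removes_rim_hook p nu nu'"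
      using that by (auto simp: is_p_core_of_def)
    \<comment> \<open>Any periodic function serves here; only the partition property and the length
      bound are extracted.\<close>
    have "periodic p (\<lambda>_. 0)" by (simp add: periodic_def)
    then have nu: "is_partition nu" "length nu \<le> length lam"
      using core_preserves_bead_sum[OF r assms(2)] by blast+
    show ?thesis
    proof (rule flush_partition_unique[OF nu(1) assms(3,1) nu(2) assms(4)])
      show "x - int p \<in> range (bead nu)" if "x \<in> range (bead nu)" for x
        using removable_rim_hook[OF nu(1), of _ p] c that by blast
    qed (use flush sums core_preserves_bead_sum[OF r assms(2)] in auto)
  qed
  show ?thesis
    unfolding p_core_def using p_core_exists[OF assms(1), of lam] eq by blast
qed

section \<open>Bead residues of JS-partitions\<close>

text \<open>Peels off the block of largest parts, on which the induction for JS-partitions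
  proceeds.\<close>

lemma partition_first_block:
  assumes "is_partition lam" "lam \<noteq> []"
  obtains a l rest where "lam = replicate (Suc a) l @ rest" "\<forall>x\<in>set rest. x < l"
proof -
  have "\<exists>a l rest. lam = replicate (Suc a) l @ rest \<and> (\<forall>x\<in>set rest. x < l)"
    using assms
  proof (induction lam)
    case (Cons x lam)
    show ?case
    proof (cases lam)
      case Nil
      then show ?thesis by (intro exI[of _ 0] exI[of _ x] exI[of _ "[]"]) simp
    next
      case (Cons y ys)
      then obtain a l rest where IH: "lam = replicate (Suc a) l @ rest" "\<forall>x\<in>set rest. x < l"
        using Cons.IH Cons.prems by (auto simp: is_partition_def)
      have "l \<le> x" using Cons.prems IH by (auto simp: is_partition_def)
      show ?thesis
      proof (cases "x = l")
        case True
        then have "x # lam = replicate (Suc (Suc a)) l @ rest" using IH by simp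
        then show ?thesis using IH(2) by blast
      next
        case False
        then have "x # lam = replicate (Suc 0) x @ lam" "\<forall>y\<in>set lam. y < x"
          using IH \<open>l \<le> x\<close> by (auto simp: less_trans)
        then show ?thesis by blast
      qed
    qed
  qed simp
  then show ?thesis using that by blast
qed

lemma sum_periodic_shift:
  assumes "periodic p g" "[s = t] (mod int p)"
  shows "(\<Sum>i<n. g (s + int i)) = (\<Sum>i<n. g (t + int i))"
  using assms by (intro sum.cong refl) (auto simp: periodic_def cong_add_rcancel)

lemma sum_lessThan_append:
  fixes f :: "nat \<Rightarrow> 'a::comm_monoid_add"
  shows "(\<Sum>i<m + n. f i) = (\<Sum>i<m. f i) + (\<Sum>i<n. f (m + i))"
  by (induction n) (simp_all add: add.assoc)

lemma sum_interval_append: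
  fixes g :: "int \<Rightarrow> int"
  shows "(\<Sum>i<m + n. g (s + int i)) = (\<Sum>i<m. g (s + int i)) + (\<Sum>i<n. g (s + int m + int i))"
  by (simp add: sum_lessThan_append add.assoc)

text \<open>Shifting the interval by 1 trades \<open>g s\<close> for \<open>g (s + n)\<close>, which
  agree when \<open>p\<close> divides \<open>n\<close>.\<close>

lemma sum_periodic_full:
  assumes "periodic p g" "p dvd n"
  shows "(\<Sum>i<n. g (s + int i)) = (\<Sum>i<n. g (t + int i))"
proof -
  have step: "(\<Sum>i<n. g (s + 1 + int i)) = (\<Sum>i<n. g (s + int i))" for s
  proof -
    have "g s + (\<Sum>i<n. g (s + 1 + int i)) = (\<Sum>i<n. g (s + int i)) + g (s + int n)"
      using sum_interval_append[of g s 1 n] sum_interval_append[of g s n 1] by simp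
    moreover have "g (s + int n) = g s"
      using assms by (simp add: periodic_def cong_iff_dvd_diff)
    ultimately show ?thesis by simp
  qed
  have "(\<Sum>i<n. g (s + int k + int i)) = (\<Sum>i<n. g (s + int i))" for s k
  proof (induction k)
    case (Suc k)
    then show ?case using step[of "s + int k"] by (simp add: algebra_simps)
  qed simp
  from this[of s "nat (t - s)"] this[of t "nat (s - t)"] show ?thesis
    by (cases "s \<le> t") simp_all
qed

lemma remdups_replicate_append:
  "l \<notin> set rest \<Longrightarrow> remdups (replicate (Suc a) l @ rest) = l # remdups rest"
  by (induction a) auto

lemma count_list_replicate: "count_list (replicate a l) x = (if x = l then a else 0)"
  by (induction a) auto

text \<open>
  The beads of the block of parts equal to \<open>l\<^sub>i\<close> form an interval, and the JS condition says that
  modulo \<open>p\<close> it ends where the interval of the next block starts. Hence the bead residues are those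
  of a single interval.
\<close>

lemma JS_bead_sum:
  assumes "JS_partition p lam" "lam \<noteq> []" "periodic p g"
  shows "(\<Sum>i<length lam. g (bead lam i)) =
    (\<Sum>i<length lam. g (int (hd lam) - int (count_list lam (hd lam)) + int i))"
  using assms
proof (induction "length lam" arbitrary: lam g rule: less_induct)
  case less
  have lam: "is_partition lam" "p_regular p lam"
    using less.prems(1) by (auto simp: JS_partition_def)
  obtain b l rest where block: "lam = replicate (Suc b) l @ rest" "\<forall>x\<in>set rest. x < l"
    by (rule partition_first_block[OF lam(1) less.prems(2)])
  define a where "a = Suc b"
  have notin: "l \<notin> set rest" using block(2) by blast
  have cnt: "count_list lam l = a" "\<And>x. x \<in> set rest \<Longrightarrow> count_list lam x = count_list rest x"
    using notin by (auto simp: block(1) a_def[symmetric] count_list_replicate)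
  have rd: "remdups lam = l # remdups rest"
    unfolding block(1) by (rule remdups_replicate_append[OF notin])
  have hd: "hd lam = l" by (simp add: block(1))
  have len: "length lam = a + length rest" by (simp add: block(1) a_def)
  have bead1: "bead lam i = int l - int i - 1" if "i < a" for i
    using that unfolding bead_def part_def block(1) a_def[symmetric] by (simp add: nth_append)
  have bead2: "bead lam (a + i) = bead rest i - int a" for i
    unfolding bead_def part_def block(1) a_def[symmetric] by (simp add: nth_append)
  have "(\<Sum>i<a. g (bead lam i)) = (\<Sum>i<a. g (int l - int i - 1))"
    by (rule sum.cong) (simp_all add: bead1)
  \<comment> \<open>Beads descend along the block; reversing the index makes the interval
    ascend.\<close>
  also have "\<dots> = (\<Sum>i<a. g (int l - int a + int i))"
    by (subst sum.nat_diff_reindex[symmetric]) (auto intro!: sum.cong arg_cong[of _ _ g])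
  finally have first: "(\<Sum>i<a. g (bead lam i)) = (\<Sum>i<a. g (int l - int a + int i))" .
  have second: "(\<Sum>i<length rest. g (bead rest i - int a)) = (\<Sum>i<length rest. g (int l + int i))"
  proof (cases "rest = []")
    case False
    have chain: "[int (remdups lam ! i) - int (remdups lam ! Suc i)
        + int (count_list lam (remdups lam ! i))
        + int (count_list lam (remdups lam ! Suc i)) = 0] (mod int p)"
      if "Suc i < length (remdups lam)" for i
      using less.prems(1) that by (auto simp: JS_partition_def Let_def)
    have mem: "remdups rest ! i \<in> set rest" if "i < length (remdups rest)" for i
      using that by (metis nth_mem set_remdups)
    have "JS_partition p rest"
      unfolding JS_partition_def Let_def
    proof (intro conjI allI impI)
      show "is_partition rest" using lam(1) by (auto simp: is_partition_def block(1) sorted_wrt_append)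
      show "p_regular p rest" using lam(2) cnt(2) by (force simp: p_regular_def block(1))
      fix i assume i: "Suc i < length (remdups rest)"
      then show "[int (remdups rest ! i) - int (remdups rest ! Suc i)
        + int (count_list rest (remdups rest ! i))
        + int (count_list rest (remdups rest ! Suc i)) = 0] (mod int p)"
        using chain[of "Suc i"] by (simp add: rd cnt(2) mem)
    qed
    \<comment> \<open>The rows of \<open>rest\<close> sit \<open>a\<close> places lower in
      \<open>lam\<close>, so the induction hypothesis is applied to a shifted function; this is why
      \<open>g\<close> is generalised.\<close>
    moreover have "periodic p (\<lambda>x. g (x - int a))"
      using less.prems(3) by (auto simp: periodic_def cong_diff)
    ultimately have "(\<Sum>i<length rest. g (bead rest i - int a)) =
        (\<Sum>i<length rest. g (int (hd rest) - int (count_list rest (hd rest)) + int i - int a))"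
      using False len by (intro less.hyps) (simp_all add: a_def)
    also have "\<dots> =
        (\<Sum>i<length rest. g (int (hd rest) - int (count_list rest (hd rest)) - int a + int i))"
      by (simp add: algebra_simps)
    also have "\<dots> = (\<Sum>i<length rest. g (int l + int i))"
    proof (rule sum_periodic_shift[OF less.prems(3)])
      have "is_partition rest" using lam(1) by (auto simp: is_partition_def block(1) sorted_wrt_append)
      then obtain b' l' rest' where r: "rest = replicate (Suc b') l' @ rest'"
          "\<forall>x\<in>set rest'. x < l'"
        using partition_first_block False by metis
      \<comment> \<open>\<open>remdups\<close> keeps last occurrences, so the block form is used to
        see that its head is \<open>hd rest\<close>.\<close>
      then have "remdups rest ! 0 = hd rest"
        using remdups_replicate_append[of l' rest' b'] by fastforce
      moreover have "0 < length (remdups rest)" using False by simp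
      ultimately have "[int l - int (hd rest) + int a + int (count_list rest (hd rest)) = 0] (mod int p)"
        using chain[of 0] cnt(1) cnt(2)[of "hd rest"] False by (simp add: rd)
      then show "[int (hd rest) - int (count_list rest (hd rest)) - int a = int l] (mod int p)"
        by (simp add: cong_iff_dvd_diff) (metis dvd_minus_iff minus_diff_eq diff_diff_eq2 add.commute diff_add_eq diff_diff_eq)
    qed
    finally show ?thesis .
  qed simp
  have "(\<Sum>i<length lam. g (bead lam i)) =
      (\<Sum>i<a. g (bead lam i)) + (\<Sum>i<length rest. g (bead lam (a + i)))"
    unfolding len by (rule sum_lessThan_append)
  also have "\<dots> = (\<Sum>i<a + length rest. g (int l - int a + int i))"
    by (simp add: first bead2 second sum_interval_append)
  finally show ?case by (simp add: hd cnt(1) len)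
qed

section \<open>Rectangular cores\<close>

text \<open>The first n beads of the rectangle fill an interval from \<open>l - a\<close> up to
  \<open>l - 1\<close> and, from the empty rows, one from \<open>- n\<close> up to
  \<open>- a - 1\<close>. Modulo \<open>p\<close> the second continues the first: it starts at
  \<open>l\<close> if n = -l, and it consists of full periods if n = a. Describing \<open>mu\<close>
  by its rows covers \<open>l = 0\<close> and \<open>a = 0\<close>, where it is the empty
  list.\<close>

lemma JS_core_rectangle:
  assumes "p \<noteq> 0" "JS_partition p lam" "lam \<noteq> []"
    and type: "[int (hd lam) - int (count_list lam (hd lam)) = int l - int a] (mod int p)"
    and small: "l + a \<le> p"
    and len: "[int (length lam) = int a] (mod int p) \<or> [int (length lam) = - int l] (mod int p)"
    and mu: "is_partition mu" "\<And>i. part mu i = (if i < a then l else 0)"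
  shows "p_core p lam = mu"
proof -
  define n where "n = length lam"
  have npos: "0 < n" using assms(3) by (simp add: n_def)
  have lam: "is_partition lam" using assms(2) by (simp add: JS_partition_def)
  \<comment> \<open>If n = a modulo \<open>p\<close> but n < a, then \<open>p\<close> would divide
    the positive number a - n < p. If n = -l, then n + l is a positive multiple of \<open>p\<close>,
    so n is at least p - l, hence at least a.\<close>
  have an: "a \<le> n"
    using len
  proof
    assume "[int (length lam) = int a] (mod int p)"
    then have c: "[n = a] (mod p)" by (simp add: cong_int_iff n_def)
    show ?thesis
    proof (rule ccontr)
      assume "\<not> a \<le> n"
      then have "p dvd a - n" using c by (metis cong_altdef_nat cong_sym linorder_le_cases)
      then have "p \<le> a - n" using \<open>\<not> a \<le> n\<close> by (intro dvd_imp_le) auto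
      then show False using small npos assms(1) by linarith
    qed
  next
    assume "[int (length lam) = - int l] (mod int p)"
    then have "int p dvd int (n + l)" by (simp add: cong_iff_dvd_diff n_def)
    then have "p dvd n + l" by (simp only: int_dvd_int_iff)
    then have "p \<le> n + l" using npos by (intro dvd_imp_le) auto
    then show ?thesis using small by simp
  qed
  have bead1: "bead mu i = int l - int i - 1" if "i < a" for i using that by (simp add: bead_def mu(2))
  have bead2: "bead mu i = - int i - 1" if "a \<le> i" for i using that by (simp add: bead_def mu(2))
  have low: "x \<in> range (bead mu)" if "x < - int a" for x
  proof -
    have "bead mu (nat (- x - 1)) = x" using that by (subst bead2) auto
    then show ?thesis by (metis rangeI)
  qed
  show ?thesis
  proof (rule p_core_eqI[OF assms(1) lam mu(1)])
    have "\<not> length lam < length mu"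
      using part_pos[OF mu(1), of "length lam"] mu(2)[of "length lam"] an by (simp add: n_def)
    then show "length mu \<le> length lam" by simp
  next
    fix x assume "x \<in> range (bead mu)"
    then obtain i where i: "x = bead mu i" by blast
    \<comment> \<open>The largest possible bead is \<open>l - 1\<close>, so
      \<open>l + a \<le> p\<close> sends every bead below \<open>- a\<close>, where all integers are
      beads.\<close>
    show "x - int p \<in> range (bead mu)"
      by (rule low, cases "i < a") (use i bead1[of i] bead2[of i] small assms(1) in auto)
  next
    fix g assume g: "periodic p g"
    have "(\<Sum>i<a. g (bead mu i)) = (\<Sum>i<a. g (int l - int i - 1))"
      by (rule sum.cong) (simp_all add: bead1)
    also have "\<dots> = (\<Sum>i<a. g (int l - int a + int i))"
      by (subst sum.nat_diff_reindex[symmetric]) (auto intro!: sum.cong arg_cong[of _ _ g])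
    finally have first: "(\<Sum>i<a. g (bead mu i)) = (\<Sum>i<a. g (int l - int a + int i))" .
    have "(\<Sum>i<n - a. g (bead mu (a + i))) = (\<Sum>i<n - a. g (- int a - 1 - int i))"
      by (rule sum.cong) (auto simp: bead2 intro: arg_cong[of _ _ g])
    also have "\<dots> = (\<Sum>i<n - a. g (- int n + int i))"
      by (subst sum.nat_diff_reindex[symmetric]) (use an in \<open>auto intro!: sum.cong arg_cong[of _ _ g]\<close>)
    also have "\<dots> = (\<Sum>i<n - a. g (int l + int i))"
      using len
    proof
      assume "[int (length lam) = int a] (mod int p)"
      then have "p dvd n - a" using an by (simp add: n_def cong_int_iff cong_altdef_nat)
      then show ?thesis by (rule sum_periodic_full[OF g])
    next
      assume "[int (length lam) = - int l] (mod int p)"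
      then have "[- int n = int l] (mod int p)"
        by (metis cong_minus_minus_iff minus_minus n_def)
      then show ?thesis by (rule sum_periodic_shift[OF g])
    qed
    finally have second: "(\<Sum>i<n - a. g (bead mu (a + i))) = (\<Sum>i<n - a. g (int l + int i))" .
    from sum_lessThan_append[of "\<lambda>i. g (bead mu i)" a "n - a"]
    have "(\<Sum>i<n. g (bead mu i)) = (\<Sum>i<a. g (bead mu i)) + (\<Sum>i<n - a. g (bead mu (a + i)))"
      using an by simp
    also have "\<dots> = (\<Sum>i<n. g (int l - int a + int i))"
      unfolding first second using sum_interval_append[of g "int l - int a" a "n - a"] an by simp
    also have "\<dots> = (\<Sum>i<n. g (int (hd lam) - int (count_list lam (hd lam)) + int i))"
      by (rule sum_periodic_shift[OF g cong_sym[OF type]])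
    also have "\<dots> = (\<Sum>i<n. g (bead lam i))"
      unfolding n_def by (rule JS_bead_sum[OF assms(2,3) g, symmetric])
    finally show "(\<Sum>i<length lam. g (bead mu i)) = (\<Sum>i<length lam. g (bead lam i))"
      by (simp add: n_def)
  qed
qed

theorem theorem3p5:
  fixes p \<alpha> :: nat and lam :: "nat list"
  assumes "2 \<le> p"
    and "JS_partition p lam" and "lam \<noteq> []"
    and "JS_type p lam = int \<alpha>"
  shows
    "(p_core p lam = [] \<or>
       (\<exists>l a. 1 \<le> l \<and> 1 \<le> a \<and> p_core p lam = replicate a l \<and>
              [int l - int a = int \<alpha>] (mod int p)))
     \<and> (\<forall>l::nat. 1 \<le> l \<and> real l \<le> real \<alpha> / 2 \<and>
          column_in_mod p (last (residue_symbol p lam))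
            {(int l - 1, int \<alpha> - int l + 1), (int \<alpha> - int l - 1, int l + 1),
             (int l, int l + 1), (int \<alpha> - int l, int \<alpha> - int l + 1)}
          \<longrightarrow> p_core p lam = replicate (p + l - \<alpha>) l)
     \<and> (\<forall>l::nat. \<alpha> + 1 \<le> l \<and> real l < (real p + 1 + real \<alpha>) / 2 \<and>
          column_in_mod p (last (residue_symbol p lam))
            {(int l - 1, int \<alpha> - int l + 1), (int \<alpha> - int l - 1, int l + 1),
             (int l, int l + 1), (int \<alpha> - int l, int \<alpha> - int l + 1)}
          \<longrightarrow> p_core p lam = replicate (l - \<alpha>) l)
     \<and> (column_in_mod p (last (residue_symbol p lam))
            {(int \<alpha> - 1, 1), (-1, int \<alpha> + 1), (0, 1), (int \<alpha>, int \<alpha> + 1)}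
          \<longrightarrow> p_core p lam = [])"
proof -
  define n where "n = length lam"
  have p: "p \<noteq> 0" using assms(1) by simp
  have alpha: "\<alpha> < p"
  proof -
    have "int \<alpha> < int p" using assms(4) p by (simp add: JS_type_def flip: assms(4))
    then show ?thesis by simp
  qed
  have type: "[int (hd lam) - int (count_list lam (hd lam)) = int \<alpha>] (mod int p)"
    using assms(4) alpha by (simp add: JS_type_def cong_def)
  have rect: "p_core p lam = replicate a l"
    if "1 \<le> l" "[int \<alpha> = int l - int a] (mod int p)" "l + a \<le> p"
      "[int n = int a] (mod int p) \<or> [int n = - int l] (mod int p)" for a l
    using that by (intro JS_core_rectangle[OF p assms(2,3) cong_trans[OF type]])
      (auto simp: n_def is_partition_def sorted_wrt_iff_nth_less part_def)
  \<comment> \<open>Two degenerate rectangles: no rows of length \<open>\<alpha>\<close>, and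
    \<open>p - \<alpha>\<close> rows of length 0.\<close>
  have empty: "p_core p lam = []"
    if "[int n = 0] (mod int p) \<or> [int n = - int \<alpha>] (mod int p)"
    using that
  proof
    assume "[int n = 0] (mod int p)"
    then show ?thesis
      using alpha
      by (intro JS_core_rectangle[OF p assms(2,3), of \<alpha> 0] type[simplified])
        (auto simp: type n_def is_partition_def part_def)
  next
    assume "[int n = - int \<alpha>] (mod int p)"
    moreover have "[- int \<alpha> = int (p - \<alpha>)] (mod int p)" "[int \<alpha> = - int (p - \<alpha>)] (mod int p)"
      using alpha by (simp_all add: cong_iff_dvd_diff of_nat_diff)
    ultimately show ?thesis
      by (intro JS_core_rectangle[OF p assms(2,3), of 0 "p - \<alpha>"])
        (auto simp: n_def is_partition_def part_def intro: cong_trans type)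
  qed
  have column: "snd (last (residue_symbol p lam)) = (1 - int n) mod int p"
    using assms(3) p by (subst residue_symbol.simps) (simp add: n_def)
  have length_cong: "[int n = 1 - y] (mod int p)"
    if "[snd (last (residue_symbol p lam)) = y] (mod int p)" for y
  proof -
    have "[1 - int n = y] (mod int p)" using that by (simp add: column cong_def)
    then have "[1 - (1 - int n) = 1 - y] (mod int p)" by (intro cong_diff cong_refl)
    then show ?thesis by simp
  qed
  \<comment> \<open>The four columns have the two second entries \<open>\<alpha> - l + 1\<close> and
    \<open>l + 1\<close>, and \<open>n\<close> is 1 minus the second entry modulo
    \<open>p\<close>.\<close>
  have cases: "[int n = int l - int \<alpha>] (mod int p) \<or> [int n = - int l] (mod int p)"
    if "column_in_mod p (last (residue_symbol p lam))
            {(int l - 1, int \<alpha> - int l + 1), (int \<alpha> - int l - 1, int l + 1),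
             (int l, int l + 1), (int \<alpha> - int l, int \<alpha> - int l + 1)}" for l
    using that length_cong[of "int \<alpha> - int l + 1"] length_cong[of "int l + 1"]
    by (auto simp: column_in_mod_def)
  have "p_core p lam = [] \<or> (\<exists>l a. 1 \<le> l \<and> 1 \<le> a \<and> p_core p lam = replicate a l \<and>
              [int l - int a = int \<alpha>] (mod int p))"
  proof -
    \<comment> \<open>The candidate has \<open>r\<close> rows of length \<open>c\<close>. If
      \<open>c + r\<close> exceeds \<open>p\<close>, the complementary rectangle with
      \<open>p - c\<close> rows of length \<open>p - r\<close> has the same difference and fits,
      matching n = -l instead of n = a.\<close>
    define r where "r = n mod p"
    define c where "c = (\<alpha> + r) mod p"
    have r: "r < p" "[int n = int r] (mod int p)" using p by (simp_all add: r_def cong_def zmod_int)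
    have c: "c < p" "[int c = int \<alpha> + int r] (mod int p)" using p by (simp_all add: c_def cong_def zmod_int)
    have cr: "[int \<alpha> = int c - int r] (mod int p)"
      using cong_diff[OF c(2) cong_refl[of "int r"]] by (simp add: cong_sym)
    consider "r = 0" | "c = 0" | "0 < r" "0 < c" "c + r \<le> p" | "0 < r" "0 < c" "p < c + r" by linarith
    then show ?thesis
    proof cases
      case 1
      then show ?thesis using empty r by simp
    next
      case 2
      then have "[int r = - int \<alpha>] (mod int p)"
        using cr by (metis cong_minus_minus_iff cong_sym diff_0 minus_minus of_nat_0)
      then show ?thesis using empty cong_trans[OF r(2)] by blast
    next
      case 3
      then show ?thesis using rect[of c r] cr r(2) cong_sym[OF cr] by force
    next
      case 4
      have "[int r = - int (p - r)] (mod int p)"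
        using r by (simp add: cong_iff_dvd_diff of_nat_diff)
      moreover have "int (p - r) - int (p - c) = int c - int r" using r c by (simp add: of_nat_diff)
      ultimately have "p_core p lam = replicate (p - c) (p - r)"
        "[int (p - r) - int (p - c) = int \<alpha>] (mod int p)"
        using rect[of "p - r" "p - c"] 4 r c cr cong_trans[OF r(2)] by (auto simp: cong_sym)
      moreover have "1 \<le> p - r" "1 \<le> p - c" using r c by auto
      ultimately show ?thesis by blast
    qed
  qed
  moreover have "p_core p lam = replicate (p + l - \<alpha>) l"
    if l: "1 \<le> l" "real l \<le> real \<alpha> / 2"
      and col: "column_in_mod p (last (residue_symbol p lam))
            {(int l - 1, int \<alpha> - int l + 1), (int \<alpha> - int l - 1, int l + 1),
             (int l, int l + 1), (int \<alpha> - int l, int \<alpha> - int l + 1)}" for l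
  proof (rule rect[OF l(1)])
    \<comment> \<open>This bound is exactly \<open>l + a \<le> p\<close> for
      \<open>a = p + l - \<alpha>\<close>.\<close>
    have l2: "2 * l \<le> \<alpha>" using l(2) by linarith
    have a: "int (p + l - \<alpha>) = int p + (int l - int \<alpha>)" using alpha by (simp add: of_nat_diff)
    show "[int \<alpha> = int l - int (p + l - \<alpha>)] (mod int p)" by (simp add: a cong_iff_dvd_diff)
    show "l + (p + l - \<alpha>) \<le> p" using l2 alpha by simp
    have "[int l - int \<alpha> = int (p + l - \<alpha>)] (mod int p)" by (simp add: a cong_iff_dvd_diff)
    then show "[int n = int (p + l - \<alpha>)] (mod int p) \<or> [int n = - int l] (mod int p)"
      using cases[OF col] cong_trans by blast
  qed
  moreover have "p_core p lam = replicate (l - \<alpha>) l"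
    if l: "\<alpha> + 1 \<le> l" "real l < (real p + 1 + real \<alpha>) / 2"
      and col: "column_in_mod p (last (residue_symbol p lam))
            {(int l - 1, int \<alpha> - int l + 1), (int \<alpha> - int l - 1, int l + 1),
             (int l, int l + 1), (int \<alpha> - int l, int \<alpha> - int l + 1)}" for l
  proof (rule rect)
    \<comment> \<open>Over the integers the strict bound says
      \<open>2 * l \<le> p + \<alpha>\<close>, which is \<open>l + a \<le> p\<close> for
      \<open>a = l - \<alpha>\<close>.\<close>
    have "real (2 * l) < real (p + 1 + \<alpha>)" using l(2) by simp
    then have "2 * l < p + 1 + \<alpha>" by (simp only: of_nat_less_iff)
    then show "l + (l - \<alpha>) \<le> p" using l(1) by simp
    show "1 \<le> l" using l(1) by simp
    have a: "int (l - \<alpha>) = int l - int \<alpha>" using l(1) by (simp add: of_nat_diff)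
    show "[int \<alpha> = int l - int (l - \<alpha>)] (mod int p)" by (simp add: a)
    show "[int n = int (l - \<alpha>)] (mod int p) \<or> [int n = - int l] (mod int p)"
      using cases[OF col] by (simp add: a)
  qed
  moreover have "p_core p lam = []"
    if "column_in_mod p (last (residue_symbol p lam))
            {(int \<alpha> - 1, 1), (-1, int \<alpha> + 1), (0, 1), (int \<alpha>, int \<alpha> + 1)}"
    using that length_cong[of 1] length_cong[of "int \<alpha> + 1"]
    by (intro empty) (auto simp: column_in_mod_def)
  ultimately show ?thesis by blast
qed

end
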